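(* Let $G$ and $H$ be finite simple graphs whose vertex sets are subsets of a common set, and let $g:V(G)\cup V(H)\to\mathbb{R}$ be locally injective on $G$ and on $H$. For $v\in V(G)$ let $S_g(v)$ be the subgraph of $G$ induced by $\{u\in S_G(v): g(u)<g(v)\}$ and $B_g(v)$ the subgraph of $G$ induced by $\{u\in S_G(v): g(u)<g(v)\}\cup\{v\}$; for $w\in V(H)$ define $S_g(w)$, $B_g(w)$ analogously inside $H$. Then $$ f_{G,H}(t,s)=\sum_{v\in V(G)}\sum_{w\in V(H)}\Big( f_{B_g(v),B_g(w)}(t,s)-f_{B_g(v),S_g(w)}(t,s)-f_{S_g(v),B_g(w)}(t,s)+f_{S_g(v),S_g(w)}(t,s)\Big). $$
   Context: A function is locally injective on a graph if adjacent vertices get different values. $S_G(v)$ is the unit sphere of $v$ in $G$, i.e. the set of neighbors of $v$. An $i$-dimensional simplex of a graph is a complete subgraph with $i+1$ vertices (identified with its vertex set). For finite simple graphs $A,B$, $f_{ij}(A,B)$ is the number of pairs $(x,y)$ with $x$ an $i$-dimensional simplex of $A$ and $y$ a $j$-dimensional simplex of $B$ such that $x\cap y\ne\emptyset$, and the $f$-intersection function is $f_{A,B}(t,s)=\sum_{i,j} f_{ij}(A,B)\,t^i s^j$ (zero if $A$ or $B$ is empty). *)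

theory Defs
  imports "Graph_Theory.Graph_Theory"
begin

text \<open>
  A finite simple graph is a digraph satisfying the predicate \<open>graph\<close>: finite, without loops or
  parallel arcs, and with a symmetric adjacency relation \<open>u \<rightarrow>\<^bsub>G\<^esub> v\<close>.
  Graphs whose vertices lie in a common set are graphs over the same vertex type \<open>'a\<close>;
  their arc types are irrelevant and may differ.
\<close>

definition locally_injective :: "('a, 'b) pre_digraph \<Rightarrow> ('a \<Rightarrow> real) \<Rightarrow> bool" where
  "locally_injective G g \<longleftrightarrow> (\<forall>u v. u \<rightarrow>\<^bsub>G\<^esub> v \<longrightarrow> g u \<noteq> g v)"

definition unit_sphere :: "('a, 'b) pre_digraph \<Rightarrow> 'a \<Rightarrow> 'a set" where
  "unit_sphere G v = {u \<in> verts G. v \<rightarrow>\<^bsub>G\<^esub> u}"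

definition lower_sphere :: "('a, 'b) pre_digraph \<Rightarrow> ('a \<Rightarrow> real) \<Rightarrow> 'a \<Rightarrow> ('a, 'b) pre_digraph" where
  "lower_sphere G g v = G \<restriction> {u \<in> unit_sphere G v. g u < g v}"

definition lower_ball :: "('a, 'b) pre_digraph \<Rightarrow> ('a \<Rightarrow> real) \<Rightarrow> 'a \<Rightarrow> ('a, 'b) pre_digraph" where
  "lower_ball G g v = G \<restriction> ({u \<in> unit_sphere G v. g u < g v} \<union> {v})"

text \<open>
  In a simple graph a complete subgraph is determined by its vertex set, and it is the subgraph
  induced by that set. The predicate \<open>complete_digraph n\<close> (written \<open>K\<^bsub>n\<^esub>\<close>) includes that there
  are exactly \<open>n\<close> vertices, so simplices are nonempty.
\<close>

definition simplices :: "('a, 'b) pre_digraph \<Rightarrow> nat \<Rightarrow> 'a set set" where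
  "simplices A i = {x. x \<subseteq> verts A \<and> complete_digraph (i + 1) (A \<restriction> x)}"

definition f_intersection_number ::
    "('a, 'b) pre_digraph \<Rightarrow> ('a, 'c) pre_digraph \<Rightarrow> nat \<Rightarrow> nat \<Rightarrow> nat" where
  "f_intersection_number A B i j =
     card {(x, y). x \<in> simplices A i \<and> y \<in> simplices B j \<and> x \<inter> y \<noteq> {}}"

text \<open>
  A simplex of dimension \<open>i\<close> has \<open>i + 1\<close> vertices, so the sums below contain all nonzero terms.
  They are empty if \<open>A\<close> or \<open>B\<close> is empty. The arguments \<open>t\<close> and \<open>s\<close> range over an arbitrary
  commutative ring: real numbers are included, and so are the two indeterminates of
  a polynomial ring over the integers.
\<close>

definition f_intersection ::
    "('a, 'b) pre_digraph \<Rightarrow> ('a, 'c) pre_digraph \<Rightarrow> 'r::comm_ring_1 \<Rightarrow> 'r \<Rightarrow> 'r" where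
  "f_intersection A B t s =
     (\<Sum>i<card (verts A). \<Sum>j<card (verts B).
        of_nat (f_intersection_number A B i j) * t ^ i * s ^ j)"

end

theory Submission
  imports Defs
begin

text \<open>
  The function \<open>f_intersection A B t s\<close> is a sum over pairs of cliques, hence additive in the
  set of cliques of \<open>A\<close> and in that of \<open>B\<close>. The alternating sum therefore retains the pairs
  \<open>(x, y)\<close> in which \<open>x\<close> is a clique of \<open>B\<^sub>g(v)\<close> but not of \<open>S\<^sub>g(v)\<close>, that is, a clique of \<open>G\<close>
  on which \<open>g\<close> attains its strict maximum at \<open>v\<close>, and likewise for \<open>y\<close> and \<open>w\<close>. By local
  injectivity \<open>g\<close> is injective on every clique, so each clique has exactly one such vertex.
\<close>

definition cliques :: "('a, 'b) pre_digraph \<Rightarrow> 'a set set" where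
  "cliques A = (\<Union>i. simplices A i)"

definition peak_cliques :: "('a, 'b) pre_digraph \<Rightarrow> ('a \<Rightarrow> real) \<Rightarrow> 'a \<Rightarrow> 'a set set" where
  "peak_cliques G g v = {x \<in> cliques G. v \<in> x \<and> (\<forall>u\<in>x. u \<noteq> v \<longrightarrow> g u < g v)}"

lemma simplices_subset: "x \<in> simplices A i \<Longrightarrow> x \<subseteq> verts A"
  by (simp add: simplices_def)

lemma card_simplex: "x \<in> simplices A i \<Longrightarrow> card x = Suc i"
  by (simp add: simplices_def complete_digraph_def)

lemma cliques_subset: "x \<in> cliques A \<Longrightarrow> x \<subseteq> verts A"
  by (auto simp: cliques_def dest: simplices_subset)

lemma finite_cliques: "finite (verts A) \<Longrightarrow> finite (cliques A)"
  by (rule finite_subset[of _ "Pow (verts A)"]) (auto dest: cliques_subset)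

lemma finite_simplices: "finite (verts A) \<Longrightarrow> finite (simplices A i)"
  by (rule finite_subset[OF _ finite_cliques]) (auto simp: cliques_def)

lemma cliques_nonempty: "x \<in> cliques A \<Longrightarrow> x \<noteq> {}"
  by (auto simp: cliques_def dest: card_simplex)

lemma cliques_adjacent:
  assumes "x \<in> cliques A" "u \<in> x" "v \<in> x" "u \<noteq> v"
  shows "u \<rightarrow>\<^bsub>A\<^esub> v"
proof -
  have "u \<rightarrow>\<^bsub>A \<restriction> x\<^esub> v"
    using assms by (auto simp: cliques_def simplices_def complete_digraph_def)
  then show ?thesis
    by (rule dominates_induce_subgraphD)
qed

lemma induce_subgraph_induce_subgraph: "x \<subseteq> W \<Longrightarrow> (A \<restriction> W) \<restriction> x = A \<restriction> x"
  by (auto simp: induce_subgraph_def)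

lemma simplices_induce_subgraph:
  "W \<subseteq> verts A \<Longrightarrow> simplices (A \<restriction> W) i = {x \<in> simplices A i. x \<subseteq> W}"
  by (auto simp: simplices_def induce_subgraph_induce_subgraph)

lemma cliques_induce_subgraph:
  "W \<subseteq> verts A \<Longrightarrow> cliques (A \<restriction> W) = {x \<in> cliques A. x \<subseteq> W}"
  by (auto simp: cliques_def simplices_induce_subgraph)

lemma simplices_dim_less:
  assumes "finite (verts A)" "x \<in> simplices A i"
  shows "i < card (verts A)"
  using card_mono[OF assms(1) simplices_subset[OF assms(2)]] card_simplex[OF assms(2)] by simp

text \<open>The cardinality of a clique fixes its dimension, so the sets of simplices of different
  dimensions are disjoint; a dimension is always below the number of vertices, so the bounded range
  loses nothing.\<close>

lemma sum_cliques:
  fixes h :: "'a set \<Rightarrow> 'r::comm_monoid_add"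
  assumes "finite (verts A)"
  shows "sum h (cliques A) = (\<Sum>i<card (verts A). sum h (simplices A i))"
proof -
  have "cliques A = (\<Union>i<card (verts A). simplices A i)"
    using simplices_dim_less[OF assms] by (auto simp: cliques_def)
  moreover have "simplices A i \<inter> simplices A j = {}" if "i \<noteq> j" for i j
    using that by (auto dest!: card_simplex)
  ultimately show ?thesis
    by (simp add: sum.UNION_disjoint finite_simplices[OF assms])
qed

text \<open>Trades the sum over dimensions for a sum whose summand depends on the two vertex sets
  alone. This is what makes \<open>f_intersection\<close> additive in each set of cliques.\<close>

lemma f_intersection_eq_sum_cliques:
  fixes t s :: "'r::comm_ring_1"
  assumes "finite (verts A)" "finite (verts B)"
  shows "f_intersection A B t s =
    (\<Sum>x\<in>cliques A. \<Sum>y\<in>cliques B.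
       if x \<inter> y \<noteq> {} then t ^ (card x - 1) * s ^ (card y - 1) else 0)"
    (is "_ = (\<Sum>x\<in>_. \<Sum>y\<in>_. ?\<phi> x y)")
proof -
  have "of_nat (f_intersection_number A B i j) * t ^ i * s ^ j =
    (\<Sum>x\<in>simplices A i. \<Sum>y\<in>simplices B j. ?\<phi> x y)" for i j
  proof -
    let ?P = "simplices A i \<times> simplices B j"
    let ?M = "{(x, y). x \<in> simplices A i \<and> y \<in> simplices B j \<and> x \<inter> y \<noteq> {}}"
    have fin: "finite ?P"
      by (simp add: finite_simplices assms)
    have "(\<Sum>x\<in>simplices A i. \<Sum>y\<in>simplices B j. ?\<phi> x y) = (\<Sum>p\<in>?P. ?\<phi> (fst p) (snd p))"
      by (simp add: sum.cartesian_product case_prod_beta)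
    also have "\<dots> = (\<Sum>p\<in>?M. ?\<phi> (fst p) (snd p))"
      by (rule sum.mono_neutral_right[OF fin]) auto
    \<comment> \<open>On \<open>?M\<close> the cardinalities are \<open>i + 1\<close> and
      \<open>j + 1\<close>, so the weight is constant and the sum counts \<open>?M\<close>.\<close>
    also have "\<dots> = (\<Sum>p\<in>?M. t ^ i * s ^ j)"
      by (rule sum.cong) (auto simp: card_simplex)
    finally show ?thesis
      by (simp add: f_intersection_number_def mult.assoc)
  qed
  then have "f_intersection A B t s =
    (\<Sum>i<card (verts A). \<Sum>j<card (verts B). \<Sum>x\<in>simplices A i. \<Sum>y\<in>simplices B j. ?\<phi> x y)"
    by (simp add: f_intersection_def)
  also have "\<dots> = (\<Sum>i<card (verts A). \<Sum>x\<in>simplices A i. \<Sum>j<card (verts B).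
      \<Sum>y\<in>simplices B j. ?\<phi> x y)"
    by (rule sum.cong[OF refl], rule sum.swap)
  also have "\<dots> = (\<Sum>x\<in>cliques A. \<Sum>y\<in>cliques B. ?\<phi> x y)"
    by (simp only: sum_cliques assms)
  finally show ?thesis .
qed

lemma cliques_lower_sphere_subset:
  assumes "v \<in> verts G"
  shows "cliques (lower_sphere G g v) \<subseteq> cliques (lower_ball G g v)"
  using assms unfolding lower_sphere_def lower_ball_def
  by (subst (1 2) cliques_induce_subgraph) (auto simp: unit_sphere_def)

text \<open>As \<open>g v < g v\<close> fails, a clique inside the ball leaves the sphere exactly
  when it contains \<open>v\<close>. In a clique containing \<open>v\<close> all other vertices are
  neighbors of \<open>v\<close>, so only the inequality on \<open>g\<close> is left as a
  condition.\<close>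

lemma cliques_lower_ball_minus_sphere:
  assumes "v \<in> verts G"
  shows "cliques (lower_ball G g v) - cliques (lower_sphere G g v) = peak_cliques G g v"
    (is "?L = ?R")
proof -
  let ?S = "{u \<in> unit_sphere G v. g u < g v}"
  have "?L = {x \<in> cliques G. x \<subseteq> ?S \<union> {v}} - {x \<in> cliques G. x \<subseteq> ?S}"
    using assms unfolding lower_sphere_def lower_ball_def
    by (subst (1 2) cliques_induce_subgraph) (auto simp: unit_sphere_def)
  also have "\<dots> = ?R"
  proof -
    have "x \<subseteq> ?S \<union> {v} \<and> \<not> x \<subseteq> ?S \<longleftrightarrow> v \<in> x \<and> (\<forall>u\<in>x. u \<noteq> v \<longrightarrow> g u < g v)"
      if x: "x \<in> cliques G" for x
    proof -
      have "u \<in> unit_sphere G v" if "u \<in> x" "v \<in> x" "u \<noteq> v" for u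
        using that cliques_adjacent[OF x] cliques_subset[OF x] by (auto simp: unit_sphere_def)
      then show ?thesis
        by auto
    qed
    then show ?thesis
      by (auto simp: peak_cliques_def)
  qed
  finally show ?thesis .
qed

lemma cliques_eq_UN_peak_cliques:
  assumes "finite (verts G)" "locally_injective G g"
  shows "cliques G = (\<Union>v\<in>verts G. peak_cliques G g v)"
proof (intro equalityI subsetI)
  fix x assume x: "x \<in> cliques G"
  have "finite x" "x \<noteq> {}"
    using x assms(1) by (auto dest: cliques_subset finite_subset cliques_nonempty)
  then have "Max (g ` x) \<in> g ` x"
    by simp
  then obtain v where "v \<in> x" "g v = Max (g ` x)"
    by auto
  with \<open>finite x\<close> have v: "v \<in> x" "\<And>u. u \<in> x \<Longrightarrow> g u \<le> g v"
    by simp_all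
  \<comment> \<open>Distinct vertices of a clique are adjacent, so local injectivity excludes
    equality and the maximum is strict.\<close>
  have "g u < g v" if "u \<in> x" "u \<noteq> v" for u
    using v(2)[OF that(1)] cliques_adjacent[OF x that(1) v(1) that(2)] assms(2)
    by (force simp: locally_injective_def)
  then show "x \<in> (\<Union>v\<in>verts G. peak_cliques G g v)"
    using x v(1) cliques_subset[OF x] by (auto simp: peak_cliques_def)
qed (auto simp: peak_cliques_def)

text \<open>The peak cliques partition all cliques: two distinct peaks \<open>v\<close> and
  \<open>w\<close> of one clique would give both \<open>g v < g w\<close> and
  \<open>g w < g v\<close>.\<close>

lemma sum_cliques_eq_sum_peak_cliques:
  fixes h :: "'a set \<Rightarrow> 'r::comm_monoid_add"
  assumes "finite (verts G)" "locally_injective G g"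
  shows "sum h (cliques G) = (\<Sum>v\<in>verts G. sum h (peak_cliques G g v))"
proof -
  have "finite (peak_cliques G g v)" for v
    using finite_cliques[OF assms(1)] by (simp add: peak_cliques_def)
  moreover have "peak_cliques G g v \<inter> peak_cliques G g w = {}" if "v \<noteq> w" for v w
    using that by (force simp: peak_cliques_def)
  ultimately show ?thesis
    unfolding cliques_eq_UN_peak_cliques[OF assms]
    by (intro sum.UNION_disjoint) (auto simp: assms)
qed

text \<open>Inclusion-exclusion on a product: this is the shape of the alternating sum in the
  theorem, with balls for \<open>X\<close>, \<open>Y\<close> and spheres for \<open>X'\<close>,
  \<open>Y'\<close>.\<close>

lemma sum_sum_diff:
  fixes \<phi> :: "'x \<Rightarrow> 'y \<Rightarrow> 'r::ab_group_add"
  assumes "finite X" "X' \<subseteq> X" "finite Y" "Y' \<subseteq> Y"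
  shows "(\<Sum>x\<in>X. \<Sum>y\<in>Y. \<phi> x y) - (\<Sum>x\<in>X. \<Sum>y\<in>Y'. \<phi> x y)
       - (\<Sum>x\<in>X'. \<Sum>y\<in>Y. \<phi> x y) + (\<Sum>x\<in>X'. \<Sum>y\<in>Y'. \<phi> x y)
       = (\<Sum>x\<in>X - X'. \<Sum>y\<in>Y - Y'. \<phi> x y)"
  by (simp add: sum_diff[OF assms(1,2)] sum_diff[OF assms(3,4)] sum_subtractf algebra_simps)

theorem theorem2:
  fixes G :: "('a, 'b) pre_digraph" and H :: "('a, 'c) pre_digraph"
    and g :: "'a \<Rightarrow> real" and t s :: "'r::comm_ring_1"
  assumes "graph G" and "graph H"
    and "locally_injective G g" and "locally_injective H g"
  shows "f_intersection G H t s =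
    (\<Sum>v\<in>verts G. \<Sum>w\<in>verts H.
        f_intersection (lower_ball G g v) (lower_ball H g w) t s
      - f_intersection (lower_ball G g v) (lower_sphere H g w) t s
      - f_intersection (lower_sphere G g v) (lower_ball H g w) t s
      + f_intersection (lower_sphere G g v) (lower_sphere H g w) t s)"
proof -
  interpret G: graph G by fact
  interpret H: graph H by fact
  \<comment> \<open>One weight serves all pairs of graphs, so the four terms of the alternating sum
    can be combined.\<close>
  define \<phi> where "\<phi> x y = (if x \<inter> y \<noteq> {} then t ^ (card x - 1) * s ^ (card y - 1) else 0)"
    for x y :: "'a set"
  have f_eq: "f_intersection A B t s = (\<Sum>x\<in>cliques A. \<Sum>y\<in>cliques B. \<phi> x y)"
    if "finite (verts A)" "finite (verts B)"
    for A :: "('a, 'd) pre_digraph" and B :: "('a, 'e) pre_digraph"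
    unfolding \<phi>_def by (rule f_intersection_eq_sum_cliques[OF that])
  have finite_lower: "finite (verts (lower_ball A g v))" "finite (verts (lower_sphere A g v))"
    if "finite (verts A)" for A :: "('a, 'd) pre_digraph" and v
    using that by (simp_all add: lower_ball_def lower_sphere_def unit_sphere_def)
  have peaks: "f_intersection (lower_ball G g v) (lower_ball H g w) t s
      - f_intersection (lower_ball G g v) (lower_sphere H g w) t s
      - f_intersection (lower_sphere G g v) (lower_ball H g w) t s
      + f_intersection (lower_sphere G g v) (lower_sphere H g w) t s
      = (\<Sum>x\<in>peak_cliques G g v. \<Sum>y\<in>peak_cliques H g w. \<phi> x y)"
    if "v \<in> verts G" "w \<in> verts H" for v w
    using that
    by (simp add: f_eq finite_lower sum_sum_diff finite_cliques
        cliques_lower_sphere_subset cliques_lower_ball_minus_sphere)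
  have "f_intersection G H t s = (\<Sum>x\<in>cliques G. \<Sum>y\<in>cliques H. \<phi> x y)"
    by (simp add: f_eq)
  also have "\<dots> = (\<Sum>v\<in>verts G. \<Sum>x\<in>peak_cliques G g v. \<Sum>w\<in>verts H.
      \<Sum>y\<in>peak_cliques H g w. \<phi> x y)"
    \<comment> \<open>\<open>g\<close> is instantiated by hand because it does not occur in the
      left-hand side of the rewrite rule.\<close>
    using assms(3,4) by (simp add: sum_cliques_eq_sum_peak_cliques[of _ g])
  also have "\<dots> = (\<Sum>v\<in>verts G. \<Sum>w\<in>verts H. \<Sum>x\<in>peak_cliques G g v.
      \<Sum>y\<in>peak_cliques H g w. \<phi> x y)"
    by (rule sum.cong[OF refl], rule sum.swap)
  finally show ?thesis
    by (simp add: peaks)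
qed

end
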